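(* Define on $D$ $$\overline V(s,x,w)=x+d_{\mathscr D}(s,x,w)+N_1(T-s),\qquad N_1=\tfrac{\sqrt2}{2}+1+2p,$$ where $d_{\mathscr D}(s,x,w)=\min\{T-s,\ w,\ \tfrac{\sqrt2}{2}(s-w),\ x\}$. Then $\overline V$ is a viscosity supersolution on $\mathscr D$ of the HJB equation $$\max\{1-V_x,\ \mathscr L[V]\}(s,x,w)=0\ \text{ for }(s,x,w)\in\mathscr D,\qquad V(T,x,w)=x,$$ and for all $(s,x,w)\in D$, $x+M_2\le\overline V(s,x,w)\le x+M_1$.
   Context: $T>0$, $p>0$, $c>0$ are constants; $G$ is a continuous distribution function on $[0,\infty)$ (of claim sizes in $[0,\infty)$); $\lambda:[0,\infty)\to[0,\infty)$ is continuous and bounded, $\lambda>0$ on $[0,T]$, and $\Lambda>0$ is a constant with $\lambda(w)\le\Lambda$ for all $w\in[0,T]$. Constants: $M_1=(\frac{\sqrt2}{2}+1+2p)T+\frac{T}{2+\sqrt2}$ and $M_2=-\big[\frac{\sqrt2}{2}+1+(c+\Lambda)\frac{2T}{2+\sqrt2}\big]T$. Domains. $D=\{(s,x,w):0\le s\le T,\ x\ge0,\ 0\le w\le s\}$, $\mathscr D=\operatorname{int}D=\{0<s<T,\ x>0,\ 0<w<s\}$, $\mathscr D^*=\{(s,x,w)\in D:\ 0\le s<T\}$. Operator. For continuously differentiable $\varphi$, $$\mathscr L[\varphi](s,x,w)=[-c\varphi+\varphi_s+p\varphi_x+\varphi_w](s,x,w)+\lambda(w)\Big[\int_0^x\varphi(s,x-u,0)\,dG(u)-\varphi(s,x,w)\Big].$$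 Viscosity supersolution. Let $O\subseteq\mathscr D^*$ with $\partial_TO:=\{(T,y,r)\in\partial O\}\ne\emptyset$, and let $\mathbb C^{1,1,1}(\bar O)$ be the continuously differentiable functions on $\bar O$. A function $v:D\to\mathbb R$, lower semicontinuous on $O$, is a viscosity supersolution of the equation on $O$ if $v(T,y,r)\ge y$ for all $(T,y,r)\in\partial_TO$ and, for every $(s,x,w)\in O$ and $\varphi\in\mathbb C^{1,1,1}(\bar O)$ with $0=[v-\varphi](s,x,w)=\min_{O}[v-\varphi]$, one has $\max\{1-\varphi_x,\mathscr L[\varphi]\}(s,x,w)\le0$. *)

theory Defs
  imports "HOL-Analysis.Analysis"
begin

text \<open>Points are triples \<open>(s, x, w)\<close>.\<close>

type_synonym pt = "real \<times> real \<times> real"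

definition dom_closed :: "real \<Rightarrow> pt set" where
  "dom_closed T = {(s, x, w). 0 \<le> s \<and> s \<le> T \<and> 0 \<le> x \<and> 0 \<le> w \<and> w \<le> s}"

definition dom_int :: "real \<Rightarrow> pt set" where
  "dom_int T = interior (dom_closed T)"

definition dom_star :: "real \<Rightarrow> pt set" where
  "dom_star T = {(s, x, w). (s, x, w) \<in> dom_closed T \<and> 0 \<le> s \<and> s < T}"

lemma dom_int_eq:
  "dom_int T = {(s, x, w). 0 < s \<and> s < T \<and> 0 < x \<and> 0 < w \<and> w < s}" (is "_ = ?E")
proof
  have "?E = {z. 0 < fst z} \<inter> {z. fst z < T} \<inter> {z. 0 < fst (snd z)} \<inter> {z. 0 < snd (snd z)}
      \<inter> {z. snd (snd z) < fst z}"
    by auto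
  moreover have "open \<dots>"
    by (intro open_Int open_Collect_less continuous_intros)
  ultimately have "open ?E" by simp
  moreover have "?E \<subseteq> dom_closed T" by (auto simp: dom_closed_def)
  ultimately show "?E \<subseteq> dom_int T" unfolding dom_int_def by (rule interior_maximal[rotated])
next
  show "dom_int T \<subseteq> ?E"
  proof
    fix z assume "z \<in> dom_int T"
    then obtain e where e: "e > 0" "ball z e \<subseteq> dom_closed T"
      by (auto simp: dom_int_def mem_interior)
    obtain s x w where z: "z = (s, x, w)" by (cases z) auto
    have near: "(s + a, x + b, w + d) \<in> dom_closed T" if "norm (a, b, d) < e" for a b d
      using that e(2) by (auto simp: z dist_norm subset_iff norm_Pair)
    show "z \<in> ?E"
      using near[of "e/2" 0 0] near[of "-(e/2)" 0 0] near[of 0 "-(e/2)" 0]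
        near[of 0 0 "e/2"] near[of 0 0 "-(e/2)"] e(1)
      by (auto simp: z dom_closed_def norm_Pair)
  qed
qed

definition terminal_bd :: "real \<Rightarrow> pt set \<Rightarrow> pt set" where
  "terminal_bd T Q = {(s, y, r). (s, y, r) \<in> frontier Q \<and> s = T}"

text \<open>A continuous distribution function of a law on \<open>[0, \<infinity>)\<close>, as a function on the whole
  line that vanishes on the negative half-line. Continuity forces \<open>G 0 = 0\<close>, so that there is
  no atom at 0 and integrals over \<open>[0, x]\<close> and \<open>(0, x]\<close> agree.\<close>

definition continuous_claim_cdf :: "(real \<Rightarrow> real) \<Rightarrow> bool" where
  "continuous_claim_cdf G \<longleftrightarrow>
     mono G \<and> continuous_on UNIV G \<and> (\<forall>u<0. G u = 0) \<and> (G \<longlongrightarrow> 1) at_top"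

text \<open>\<open>phi\<close> is continuously differentiable on \<open>S\<close> with partial derivatives \<open>phis\<close>, \<open>phix\<close>,
  \<open>phiw\<close>. On the boundary of \<open>S\<close> the derivative is taken within \<open>S\<close>. The partial derivatives
  are parameters because derivatives within a set \<open>S\<close> without interior need not be unique.\<close>

definition C111_on ::
  "pt set \<Rightarrow> (pt \<Rightarrow> real) \<Rightarrow> (pt \<Rightarrow> real) \<Rightarrow> (pt \<Rightarrow> real) \<Rightarrow> (pt \<Rightarrow> real) \<Rightarrow> bool" where
  "C111_on S phi phis phix phiw \<longleftrightarrow>
     (\<forall>z\<in>S. (phi has_derivative (\<lambda>(hs, hx, hw). phis z * hs + phix z * hx + phiw z * hw))
        (at z within S)) \<and>
     continuous_on S phis \<and> continuous_on S phix \<and> continuous_on S phiw"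

definition HJB_op ::
  "real \<Rightarrow> real \<Rightarrow> (real \<Rightarrow> real) \<Rightarrow> (real \<Rightarrow> real) \<Rightarrow>
   (pt \<Rightarrow> real) \<Rightarrow> (pt \<Rightarrow> real) \<Rightarrow> (pt \<Rightarrow> real) \<Rightarrow> (pt \<Rightarrow> real) \<Rightarrow> pt \<Rightarrow> real" where
  "HJB_op c p lam G phi phis phix phiw = (\<lambda>(s, x, w).
     - c * phi (s, x, w) + phis (s, x, w) + p * phix (s, x, w) + phiw (s, x, w)
     + lam w * ((LINT u:{0..x}|interval_measure G. phi (s, x - u, 0)) - phi (s, x, w)))"

definition lsc_on :: "'a::topological_space set \<Rightarrow> ('a \<Rightarrow> real) \<Rightarrow> bool" where
  "lsc_on S v \<longleftrightarrow> (\<forall>z\<in>S. \<forall>a. a < v z \<longrightarrow> (\<forall>\<^sub>F y in at z within S. a < v y))"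

definition viscosity_supersolution ::
  "real \<Rightarrow> real \<Rightarrow> real \<Rightarrow> (real \<Rightarrow> real) \<Rightarrow> (real \<Rightarrow> real) \<Rightarrow> pt set \<Rightarrow> (pt \<Rightarrow> real) \<Rightarrow> bool" where
  "viscosity_supersolution T c p lam G Q v \<longleftrightarrow>
     Q \<subseteq> dom_star T \<and> terminal_bd T Q \<noteq> {} \<and> lsc_on Q v \<and>
     (\<forall>y r. (T, y, r) \<in> terminal_bd T Q \<longrightarrow> v (T, y, r) \<ge> y) \<and>
     (\<forall>z\<in>Q. \<forall>phi phis phix phiw.
        C111_on (closure Q) phi phis phix phiw \<and>
        v z - phi z = 0 \<and> (\<forall>z'\<in>Q. v z - phi z \<le> v z' - phi z') \<longrightarrow>
        max (1 - phix z) (HJB_op c p lam G phi phis phix phiw z) \<le> 0)"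

definition N1 :: "real \<Rightarrow> real" where
  "N1 p = sqrt 2 / 2 + 1 + 2 * p"

definition M1 :: "real \<Rightarrow> real \<Rightarrow> real" where
  "M1 T p = (sqrt 2 / 2 + 1 + 2 * p) * T + T / (2 + sqrt 2)"

definition M2 :: "real \<Rightarrow> real \<Rightarrow> real \<Rightarrow> real" where
  "M2 T c Lam = - (sqrt 2 / 2 + 1 + (c + Lam) * (2 * T / (2 + sqrt 2))) * T"

definition bd_dist :: "real \<Rightarrow> pt \<Rightarrow> real" where
  "bd_dist T = (\<lambda>(s, x, w). Min {T - s, w, sqrt 2 / 2 * (s - w), x})"

definition Vbar :: "real \<Rightarrow> real \<Rightarrow> pt \<Rightarrow> real" where
  "Vbar T p = (\<lambda>(s, x, w). x + bd_dist T (s, x, w) + N1 p * (T - s))"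

end

theory Submission
  imports Defs
begin

text \<open>
  The boundary distance is a minimum of four affine functions, so \<^term>\<open>Vbar T p\<close> is one as
  well. A test function that touches it from below at an interior point also touches from below
  every affine piece that is active there, and therefore has exactly the gradient of that piece
  (\<open>gradient_of_test_function\<close>). At a kink, where two active pieces have different gradients, no
  test function exists and nothing has to be shown. The four gradients are explicit: each has
  \<open>x\<close>-slope 1 or 2, which settles the gradient constraint, and for each of them
  \<open>phis + p * phix + phiw\<close> is at most \<open>2 * p + 1 - N1 p \<le> 0\<close>; the time slope \<open>- N1 p\<close> is there to
  absorb the drift.

  The other terms of the operator have a sign (\<open>HJB_op_nonpos\<close>). A claim resets \<open>w\<close> to 0, a
  boundary point, where the distance vanishes. By continuity the test function stays below
  \<^term>\<open>Vbar T p\<close> on the closed domain, so after a claim it is at most \<open>x + N1 p * (T - s)\<close>. This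
  is at most the value before the claim, and claims in \<open>[0, x]\<close> have total mass at most 1, so
  the integral term cannot exceed the value before the claim. Discounting helps because that value
  is nonnegative.

  For the two-sided bound, the distance lies between 0 and \<open>T / (2 + sqrt 2)\<close> (\<open>bd_dist_le\<close>) and
  \<open>N1 p * (T - s)\<close> between 0 and \<open>N1 p * T\<close>; the upper bounds add up to \<open>M1 T p\<close>, and
  \<open>M2 T c Lam\<close> is negative.
\<close>

section \<open>The boundary distance\<close>

lemma bd_dist_eq:
  "bd_dist T (s, x, w) = min (min (T - s) w) (min (sqrt 2 / 2 * (s - w)) x)"
  by (simp add: bd_dist_def min.assoc)

lemma bd_dist_le_pieces:
  "bd_dist T (s, x, w) \<le> T - s" "bd_dist T (s, x, w) \<le> w"
  "bd_dist T (s, x, w) \<le> sqrt 2 / 2 * (s - w)" "bd_dist T (s, x, w) \<le> x"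
  unfolding bd_dist_eq by linarith+

lemma bd_dist_nonneg:
  assumes "(s, x, w) \<in> dom_closed T"
  shows "0 \<le> bd_dist T (s, x, w)"
  using assms by (simp add: bd_dist_eq dom_closed_def)

lemma bd_dist_eq_0:
  assumes "(s, x, w) \<in> dom_closed T" "s = T \<or> w = 0"
  shows "bd_dist T (s, x, w) = 0"
proof -
  have "0 \<le> sqrt 2 / 2 * (s - w)"
    using assms(1) by (simp add: dom_closed_def)
  then show ?thesis
    using assms unfolding bd_dist_eq dom_closed_def by (auto simp: min_def)
qed

text \<open>The three times \<open>T - s\<close>, \<open>w\<close> and \<open>s - w\<close> add up to \<open>T\<close>, and they are at least \<open>d\<close>, \<open>d\<close> and
  \<open>sqrt 2 * d\<close> when \<open>d\<close> is the distance.\<close>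

lemma bd_dist_le:
  assumes "(s, x, w) \<in> dom_closed T"
  shows "bd_dist T (s, x, w) \<le> T / (2 + sqrt 2)"
proof -
  define d where "d = bd_dist T (s, x, w)"
  have d: "d \<le> T - s" "d \<le> w" "d \<le> sqrt 2 / 2 * (s - w)"
    unfolding d_def by (rule bd_dist_le_pieces)+
  have "sqrt 2 * d \<le> sqrt 2 * (sqrt 2 / 2 * (s - w))"
    using d(3) by (intro mult_left_mono) auto
  also have "\<dots> = s - w"
    unfolding mult.assoc[symmetric] by simp
  finally have "(2 + sqrt 2) * d \<le> T"
    using d by (simp add: algebra_simps)
  then show ?thesis
    unfolding d_def[symmetric] by (subst pos_le_divide_eq) (auto simp: mult.commute add_pos_pos)
qed

lemma continuous_on_Vbar: "continuous_on A (Vbar T p)"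
proof -
  have "Vbar T p = (\<lambda>z. fst (snd z)
      + min (min (T - fst z) (snd (snd z))) (min (sqrt 2 / 2 * (fst z - snd (snd z))) (fst (snd z)))
      + N1 p * (T - fst z))"
    by (auto simp: Vbar_def bd_dist_eq fun_eq_iff)
  then show ?thesis
    by (auto intro!: continuous_intros)
qed

lemma Vbar_bounds:
  assumes "T > 0" "p > 0" "c > 0" "Lam > 0" "(s, x, w) \<in> dom_closed T"
  shows "x + M2 T c Lam \<le> Vbar T p (s, x, w)" "Vbar T p (s, x, w) \<le> x + M1 T p"
proof -
  have s: "0 \<le> s" "s \<le> T"
    using assms(5) by (auto simp: dom_closed_def)
  have N1: "0 \<le> N1 p"
    using assms(2) by (auto simp: N1_def)
  have "M2 T c Lam \<le> 0"
    using assms(1,3,4) unfolding M2_def by (intro mult_nonpos_nonneg)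
      (simp_all only: neg_le_0_iff_le, auto intro!: add_nonneg_nonneg mult_nonneg_nonneg divide_nonneg_nonneg)
  moreover have "0 \<le> N1 p * (T - s)"
    using N1 s by simp
  ultimately show "x + M2 T c Lam \<le> Vbar T p (s, x, w)"
    using bd_dist_nonneg[OF assms(5)] by (simp add: Vbar_def)
  have "N1 p * (T - s) \<le> N1 p * T"
    using N1 s by (intro mult_left_mono) auto
  then show "Vbar T p (s, x, w) \<le> x + M1 T p"
    using bd_dist_le[OF assms(5)] by (simp add: Vbar_def M1_def N1_def)
qed

section \<open>The closed domain\<close>

lemma convex_dom_closed: "convex (dom_closed T)"
proof -
  have "dom_closed T = {z. (- 1, 0, 0) \<bullet> z \<le> 0} \<inter> {z. (1, 0, 0) \<bullet> z \<le> T}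
      \<inter> {z. (0, - 1, 0) \<bullet> z \<le> 0} \<inter> {z. (0, 0, - 1) \<bullet> z \<le> 0} \<inter> {z. (- 1, 0, 1) \<bullet> z \<le> 0}"
    by (auto simp: dom_closed_def)
  then show ?thesis
    by (auto intro!: convex_Int convex_halfspace_le)
qed

lemma closed_dom_closed: "closed (dom_closed T)"
proof -
  have "dom_closed T = {z. 0 \<le> fst z} \<inter> {z. fst z \<le> T} \<inter> {z. 0 \<le> fst (snd z)}
      \<inter> {z. 0 \<le> snd (snd z)} \<inter> {z. snd (snd z) \<le> fst z}"
    by (auto simp: dom_closed_def)
  then show ?thesis
    by (auto intro!: closed_Int closed_Collect_le continuous_intros)
qed

lemma open_dom_int: "open (dom_int T)"
  by (simp add: dom_int_def)

text \<open>A convex set with nonempty interior lies in the closure of its interior. This lets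
  inequalities between continuous functions pass from the interior to the boundary points
  \<open>w = 0\<close> at which the integral term evaluates a test function.\<close>

lemma closure_dom_int:
  assumes "T > 0"
  shows "closure (dom_int T) = dom_closed T"
proof -
  have "(T / 2, 1, T / 4) \<in> dom_int T"
    using assms by (simp add: dom_int_eq)
  then show ?thesis
    using convex_closure_interior[OF convex_dom_closed, of T] closed_dom_closed[of T]
    by (auto simp: dom_int_def)
qed

section \<open>Gradients of test functions\<close>

text \<open>The difference from the affine function has a maximum at an interior point, so its
  derivative vanishes there.\<close>

lemma gradient_eq_if_touches_affine:
  assumes "open Q" "z \<in> Q"
    and "C111_on (closure Q) phi phis phix phiw"
    and le: "\<And>s x w. (s, x, w) \<in> Q \<Longrightarrow> phi (s, x, w) \<le> k + a * s + b * x + d * w"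
    and eq: "z = (s0, x0, w0)" "phi z = k + a * s0 + b * x0 + d * w0"
  shows "phis z = a" "phix z = b" "phiw z = d"
proof -
  let ?A = "\<lambda>z :: pt. k + a * fst z + b * fst (snd z) + d * snd (snd z)"
  let ?D = "\<lambda>h :: pt. phis z * fst h + phix z * fst (snd h) + phiw z * snd (snd h)"
  have "z \<in> closure Q"
    using assms(2) closure_subset by auto
  then have "(phi has_derivative ?D) (at z within closure Q)"
    using assms(3) by (auto simp: C111_on_def case_prod_unfold)
  then have "(phi has_derivative ?D) (at z within Q)"
    by (rule has_derivative_subset) (rule closure_subset)
  then have "(phi has_derivative ?D) (at z)"
    by (simp only: at_within_open[OF assms(2,1)])
  moreover have "(?A has_derivative (\<lambda>h. a * fst h + b * fst (snd h) + d * snd (snd h))) (at z)"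
    by (rule derivative_eq_intros refl)+ simp
  ultimately have der: "((\<lambda>y. phi y - ?A y) has_derivative
      (\<lambda>h. ?D h - (a * fst h + b * fst (snd h) + d * snd (snd h)))) (at z)"
    by (rule has_derivative_diff)
  have "(\<lambda>h. ?D h - (a * fst h + b * fst (snd h) + d * snd (snd h))) = (\<lambda>h. 0)"
  proof (rule differential_zero_maxmin[OF assms(2,1) der])
    have "phi y - ?A y \<le> phi z - ?A z" if "y \<in> Q" for y
      using le[of "fst y" "fst (snd y)" "snd (snd y)"] that eq by simp
    then show "(\<forall>y\<in>Q. phi y - ?A y \<le> phi z - ?A z) \<or> (\<forall>y\<in>Q. phi z - ?A z \<le> phi y - ?A y)"
      by blast
  qed
  then have *: "?D h - (a * fst h + b * fst (snd h) + d * snd (snd h)) = 0" for h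
    by metis
  show "phis z = a" "phix z = b" "phiw z = d"
    using *[of "(1, 0, 0)"] *[of "(0, 1, 0)"] *[of "(0, 0, 1)"] by auto
qed

text \<open>Some piece of the boundary distance is active at \<open>z\<close>; in each of the four cases the test
  function inherits the slopes of that piece. Apart from the common term
  \<open>- N1 p\<close>, the largest drift is \<open>2 * p\<close>, where the piece \<open>x\<close> is active, or \<open>p + 1\<close>, where the
  piece \<open>w\<close> is.\<close>

lemma gradient_of_test_function:
  assumes "p > 0" "z \<in> dom_int T"
    and C: "C111_on (closure (dom_int T)) phi phis phix phiw"
    and le: "\<And>y. y \<in> dom_int T \<Longrightarrow> phi y \<le> Vbar T p y" and eq: "phi z = Vbar T p z"
  shows "1 \<le> phix z" "phis z + p * phix z + phiw z \<le> 0"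
proof -
  obtain s x w where z: "z = (s, x, w)"
    by (cases z) auto
  have N1_ge: "1 + 2 * p \<le> N1 p"
    by (simp add: N1_def)
  \<comment> \<open>An affine majorant of \<^term>\<open>Vbar T p\<close> that is exact at \<^term>\<open>z\<close> is also one of
    \<^term>\<open>phi\<close>, so its slopes are the derivatives of \<^term>\<open>phi\<close>.\<close>
  have touch: "phis z = a \<and> phix z = b \<and> phiw z = d"
    if V_le: "\<And>s' x' w'. Vbar T p (s', x', w') \<le> k + a * s' + b * x' + d * w'"
      and V_eq: "Vbar T p z = k + a * s + b * x + d * w" for k a b d
  proof -
    have "phi (s', x', w') \<le> k + a * s' + b * x' + d * w'" if "(s', x', w') \<in> dom_int T" for s' x' w'
      using le[OF that] V_le by (rule order_trans)
    moreover have "phi z = k + a * s + b * x + d * w"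
      using eq V_eq by simp
    ultimately show ?thesis
      using gradient_eq_if_touches_affine[OF open_dom_int assms(2) C _ z] by blast
  qed
  have V_le: "Vbar T p (s', x', w') \<le> x' + l + N1 p * (T - s')"
    if "bd_dist T (s', x', w') \<le> l" for s' x' w' l
    using that by (simp add: Vbar_def)
  have V_eq: "Vbar T p z = x + l + N1 p * (T - s)" if "bd_dist T z = l" for l
    using that by (simp add: Vbar_def z)
  consider "bd_dist T z = T - s" | "bd_dist T z = w"
    | "bd_dist T z = sqrt 2 / 2 * (s - w)" | "bd_dist T z = x"
    unfolding z bd_dist_eq by (metis min_def)
  then have "1 \<le> phix z \<and> phis z + p * phix z + phiw z \<le> 0"
  proof cases
    case 1
    have "phis z = - 1 - N1 p \<and> phix z = 1 \<and> phiw z = 0"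
    proof (rule touch[where k = "T + N1 p * T"])
      show "Vbar T p (s', x', w') \<le> T + N1 p * T + (- 1 - N1 p) * s' + 1 * x' + 0 * w'" for s' x' w'
        using V_le[OF bd_dist_le_pieces(1)[of T s' x' w']] by (simp add: algebra_simps)
    qed (use V_eq[OF 1] in \<open>simp add: algebra_simps\<close>)
    then show ?thesis
      using assms(1) N1_ge by simp
  next
    case 2
    have "phis z = - N1 p \<and> phix z = 1 \<and> phiw z = 1"
    proof (rule touch[where k = "N1 p * T"])
      show "Vbar T p (s', x', w') \<le> N1 p * T + (- N1 p) * s' + 1 * x' + 1 * w'" for s' x' w'
        using V_le[OF bd_dist_le_pieces(2)[of T s' x' w']] by (simp add: algebra_simps)
    qed (use V_eq[OF 2] in \<open>simp add: algebra_simps\<close>)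
    then show ?thesis
      using assms(1) N1_ge by simp
  next
    case 3
    have "phis z = sqrt 2 / 2 - N1 p \<and> phix z = 1 \<and> phiw z = - (sqrt 2 / 2)"
    proof (rule touch[where k = "N1 p * T"])
      show "Vbar T p (s', x', w')
          \<le> N1 p * T + (sqrt 2 / 2 - N1 p) * s' + 1 * x' + (- (sqrt 2 / 2)) * w'" for s' x' w'
        using V_le[OF bd_dist_le_pieces(3)[of T s' x' w']] by (simp add: algebra_simps diff_divide_distrib)
    qed (use V_eq[OF 3] in \<open>simp add: algebra_simps diff_divide_distrib\<close>)
    then show ?thesis
      using assms(1) N1_ge by simp
  next
    case 4
    have "phis z = - N1 p \<and> phix z = 2 \<and> phiw z = 0"
    proof (rule touch[where k = "N1 p * T"])
      show "Vbar T p (s', x', w') \<le> N1 p * T + (- N1 p) * s' + 2 * x' + 0 * w'" for s' x' w'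
        using V_le[OF bd_dist_le_pieces(4)[of T s' x' w']] by (simp add: algebra_simps)
    qed (use V_eq[OF 4] in \<open>simp add: algebra_simps\<close>)
    then show ?thesis
      using assms(1) N1_ge by simp
  qed
  then show "1 \<le> phix z" "phis z + p * phix z + phiw z \<le> 0"
    by auto
qed

section \<open>The integral term and the operator\<close>

lemma claim_measure_Icc:
  assumes "continuous_claim_cdf G" "0 \<le> x"
  shows "emeasure (interval_measure G) {0..x} = ennreal (G x - G 0)" "G x - G 0 \<le> 1"
proof -
  have G: "mono G" "continuous_on UNIV G" "G (- 1) = 0" "(G \<longlongrightarrow> 1) at_top"
    using assms(1) by (auto simp: continuous_claim_cdf_def)
  show "emeasure (interval_measure G) {0..x} = ennreal (G x - G 0)"
    using assms(2) G(1,2) by (intro emeasure_interval_measure_Icc)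
      (auto simp: monoD continuous_on_subset)
  have "eventually (\<lambda>y. G x \<le> G y) at_top"
    using eventually_ge_at_top[of x] by eventually_elim (use G(1) in \<open>auto simp: monoD\<close>)
  then have "G x \<le> 1"
    by (rule tendsto_lowerbound[OF G(4)]) simp
  moreover have "G (- 1) \<le> G 0"
    using G(1) by (simp add: monoD)
  ultimately show "G x - G 0 \<le> 1"
    using G(3) by simp
qed

text \<open>Claims in \<open>[0, x]\<close> have mass at most 1. A nonnegative \<open>K\<close> also bounds the value 0 that the
  integral takes when \<open>f\<close> is not integrable.\<close>

lemma claim_integral_le:
  fixes f :: "real \<Rightarrow> real"
  assumes "continuous_claim_cdf G" "0 \<le> x" "0 \<le> K"
    and "\<And>u. 0 \<le> u \<Longrightarrow> u \<le> x \<Longrightarrow> f u \<le> K"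
  shows "(LINT u:{0..x}|interval_measure G. f u) \<le> K"
proof -
  note em = claim_measure_Icc[OF assms(1,2)]
  have "(LINT u:{0..x}|interval_measure G. f u)
      \<le> (LINT u|interval_measure G. K * indicator {0..x} u)"
    unfolding set_lebesgue_integral_def
  proof (rule integral_mono')
    show "integrable (interval_measure G) (\<lambda>u. K * indicator {0..x} u)"
      using em(1) by (intro integrable_mult_right integrable_real_indicator) auto
  qed (use assms(3,4) in \<open>auto simp: indicator_def\<close>)
  also have "\<dots> = K * measure (interval_measure G) {0..x}"
    by simp
  also have "\<dots> \<le> K * 1"
    using em assms(3) by (intro mult_left_mono) (auto simp: measure_def enn2real_le)
  finally show ?thesis
    by simp
qed

lemma HJB_op_nonpos:
  assumes "T > 0" "p > 0" "c > 0" "continuous_claim_cdf G" "\<And>w. 0 \<le> w \<Longrightarrow> 0 \<le> lam w"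
    and z: "z \<in> dom_int T"
    and C: "C111_on (closure (dom_int T)) phi phis phix phiw"
    and le: "\<And>y. y \<in> dom_int T \<Longrightarrow> phi y \<le> Vbar T p y" and eq: "phi z = Vbar T p z"
  shows "HJB_op c p lam G phi phis phix phiw z \<le> 0"
proof -
  obtain s x w where zd: "z = (s, x, w)"
    by (cases z) auto
  have zc: "0 < s" "s < T" "0 < x" "0 < w" "w < s"
    using z by (auto simp: zd dom_int_eq)
  \<comment> \<open>The value of \<^term>\<open>Vbar T p\<close> at \<open>(s, x, w)\<close> without the boundary distance. It lies below
    \<^term>\<open>phi z\<close> and above \<^term>\<open>phi\<close> after any claim.\<close>
  define K where "K = x + N1 p * (T - s)"
  have N1: "0 \<le> N1 p"
    using assms(2) by (auto simp: N1_def)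
  have K: "0 \<le> K"
    using N1 zc by (auto simp: K_def)
  have "0 \<le> bd_dist T z"
    unfolding zd by (rule bd_dist_nonneg) (use zc in \<open>auto simp: dom_closed_def\<close>)
  then have phi: "K \<le> phi z"
    using eq by (simp add: zd Vbar_def K_def)
  have cont: "continuous_on (closure (dom_int T)) (\<lambda>y. phi y - Vbar T p y)"
  proof (intro continuous_on_diff continuous_on_Vbar)
    show "continuous_on (closure (dom_int T)) phi"
      using C unfolding C111_on_def continuous_on_eq_continuous_within
      by (blast intro: has_derivative_continuous)
  qed
  have le_closed: "phi y \<le> Vbar T p y" if "y \<in> dom_closed T" for y
    using continuous_le_on_closure[OF cont, of y 0] that le closure_dom_int[OF assms(1)] by auto
  have "(LINT u:{0..x}|interval_measure G. phi (s, x - u, 0)) \<le> K"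
  proof (rule claim_integral_le[OF assms(4) _ K])
    fix u assume u: "0 \<le> u" "u \<le> x"
    then have "(s, x - u, 0) \<in> dom_closed T"
      using zc by (auto simp: dom_closed_def)
    from le_closed[OF this] bd_dist_eq_0[OF this] show "phi (s, x - u, 0) \<le> K"
      using u by (simp add: Vbar_def K_def)
  qed (use zc in auto)
  then have "lam w * ((LINT u:{0..x}|interval_measure G. phi (s, x - u, 0)) - phi z) \<le> 0"
    using phi assms(5) zc by (intro mult_nonneg_nonpos) auto
  moreover have "0 \<le> c * phi z"
    using assms(3) phi K by simp
  ultimately show ?thesis
    using gradient_of_test_function(2)[OF assms(2) z C le eq]
    by (simp add: HJB_op_def zd)
qed

section \<open>The supersolution property and the bounds\<close>

theorem theorem6p2:
  fixes T p c Lam :: real and lam G :: "real \<Rightarrow> real"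
  assumes "T > 0" and "p > 0" and "c > 0" and "Lam > 0"
    and "continuous_claim_cdf G"
    and "continuous_on {0..} lam" and "bounded (lam ` {0..})"
    and "\<forall>w\<ge>0. lam w \<ge> 0"
    and "\<forall>w\<in>{0..T}. lam w > 0"
    and "\<forall>w\<in>{0..T}. lam w \<le> Lam"
  shows "viscosity_supersolution T c p lam G (dom_int T) (Vbar T p) \<and>
    (\<forall>s x w. (s, x, w) \<in> dom_closed T \<longrightarrow>
       x + M2 T c Lam \<le> Vbar T p (s, x, w) \<and> Vbar T p (s, x, w) \<le> x + M1 T p)"
proof -
  have "viscosity_supersolution T c p lam G (dom_int T) (Vbar T p)"
    unfolding viscosity_supersolution_def
  proof (intro conjI ballI allI impI)
    show "dom_int T \<subseteq> dom_star T"
      by (auto simp: dom_int_eq dom_star_def dom_closed_def)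
    have "(T, 1, T / 2) \<in> terminal_bd T (dom_int T)"
      unfolding terminal_bd_def frontier_def closure_dom_int[OF assms(1)] interior_open[OF open_dom_int]
      using assms(1) by (simp add: dom_int_eq dom_closed_def)
    then show "terminal_bd T (dom_int T) \<noteq> {}"
      by blast
    show "lsc_on (dom_int T) (Vbar T p)"
      unfolding lsc_on_def
      using continuous_on_Vbar[of "dom_int T" T p]
      by (auto simp: continuous_on_def intro: order_tendstoD)
  next
    fix y r
    assume "(T, y, r) \<in> terminal_bd T (dom_int T)"
    then have "(T, y, r) \<in> dom_closed T"
      using closure_dom_int[OF assms(1)] by (auto simp: terminal_bd_def frontier_def)
    then show "y \<le> Vbar T p (T, y, r)"
      using bd_dist_nonneg by (auto simp: Vbar_def)
  next
    fix z phi phis phix phiw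
    assume z: "z \<in> dom_int T"
      and *: "C111_on (closure (dom_int T)) phi phis phix phiw \<and> Vbar T p z - phi z = 0 \<and>
        (\<forall>z'\<in>dom_int T. Vbar T p z - phi z \<le> Vbar T p z' - phi z')"
    have "phi y \<le> Vbar T p y" if "y \<in> dom_int T" for y
      using * that by force
    then show "max (1 - phix z) (HJB_op c p lam G phi phis phix phiw z) \<le> 0"
      using gradient_of_test_function(1)[OF assms(2) z] HJB_op_nonpos[OF assms(1-3,5) _ z]
        * assms(8) by auto
  qed
  then show ?thesis
    using Vbar_bounds[OF assms(1-4)] by blast
qed

end
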